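(* Let $k$ be a domain, let $n\ge 1$, and let $k[\mathbf{x}]=k[x_1,\ldots,x_n]$ be the polynomial ring in $n$ variables over $k$. Then no stable $\mathbf{G}_{\rm a}$-invariant of $k[\mathbf{x}]$ has an intruder.
   Context: "Domain" means commutative integral domain. Intruders. For $f=\sum u_{i_1,\ldots,i_n}x_1^{i_1}\cdots x_n^{i_n}\in k[\mathbf{x}]$ with $u_{i_1,\ldots,i_n}\in k$, set $\operatorname{supp}(f)=\{(i_1,\ldots,i_n)\mid u_{i_1,\ldots,i_n}\ne 0\}$. The Newton polytope $\operatorname{New}(f)$ is the convex hull of $\operatorname{supp}(f)$ in $\mathbf{R}^n$. A vertex $(i_1,\ldots,i_n)$ of $\operatorname{New}(f)$ is an intruder of $f$ if $i_l\neq 0$ for all $l=1,\ldots,n$. $\mathbf{G}_{\rm a}$-actions. Let $z$ be an indeterminate and, for $m\geq 1$, let $B=k[x_1,\ldots,x_m]$. A $\mathbf{G}_{\rm a}$-action on $B$ is a homomorphism of $k$-algebras $\sigma:B\to B[z]=B\otimes_k k[z]$ such that $\pi\circ\sigma=\mathrm{id}_B$ and $(\sigma\otimes \mathrm{id}_{k[z]})\circ\sigma=(\mathrm{id}_B\otimes\mu)\circ\sigma$ as maps $B\to B\otimes_k k[z]\otimes_k k[z]$, where $\pi:B[z]\to B$ is the $B$-algebra homomorphism with $\pi(z)=0$ and $\mu:k[z]\to k[z]\otimes_k k[z]$ is the $k$-algebra homomorphism with $\mu(z)=z\otimes 1+1\otimes z$. The ring of invariants is $B^{\mathbf{G}_{\rm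 a}}:=\sigma^{-1}(B)$ (for $f\in B$, $\sigma(f)\in B$ if and only if $\sigma(f)=f$). Stable invariants. For $m\ge n$, write $k[\overline{\mathbf{x}}]=k[x_1,\ldots,x_m]\supseteq k[\mathbf{x}]$. An element $f\in k[\mathbf{x}]$ is a stable $\mathbf{G}_{\rm a}$-invariant of $k[\mathbf{x}]$ if there exist $m\ge n$ and a $\mathbf{G}_{\rm a}$-action on $k[\overline{\mathbf{x}}]$ for which $k[\overline{\mathbf{x}}]^{\mathbf{G}_{\rm a}}$ contains $f$ but does not contain $k[\mathbf{x}]$. *)

theory Defs
  imports
    "HOL-Analysis.Analysis"
    "HOL-Library.Poly_Mapping"
    "HOL-Computational_Algebra.Polynomial"
begin

text \<open>
  Polynomials with coefficients in \<open>'k\<close> and variables indexed by \<open>'v\<close>, as the monoid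
  algebra of finitely supported exponent vectors; multiplication is convolution.
\<close>

type_synonym ('v, 'k) mpol = "('v \<Rightarrow>\<^sub>0 nat) \<Rightarrow>\<^sub>0 'k"

definition const_mpol :: "'k::zero \<Rightarrow> ('v, 'k) mpol" where
  "const_mpol c = Poly_Mapping.single 0 c"

definition polys_in :: "'v set \<Rightarrow> ('v, 'k::zero) mpol set" where
  "polys_in V = {f. \<forall>a \<in> Poly_Mapping.keys f. Poly_Mapping.keys a \<subseteq> V}"

text \<open>
  With \<open>n = CARD('n)\<close>, the variables \<open>x\<^sub>1, \<dots>, x\<^sub>n\<close> are the
  \<open>Inl i\<close>, and the further variables \<open>x\<^bsub>n+1\<^esub>, x\<^bsub>n+2\<^esub>, \<dots>\<close> are
  \<open>Inr 0, Inr 1, \<dots>\<close>.  Thus the rings \<open>k[x\<^sub>1, \<dots>, x\<^sub>m]\<close> for \<open>m \<ge> n\<close> are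
  nested subrings of one type.
\<close>

definition first_vars :: "nat \<Rightarrow> ('n::finite + nat) set" where
  "first_vars m = range Inl \<union> Inr ` {..<m - CARD('n)}"

definition poly_ring :: "nat \<Rightarrow> ('n::finite + nat, 'k::zero) mpol set" where
  "poly_ring m = polys_in (first_vars m)"


subsection \<open>Intruders\<close>

text \<open>
  The exponents are read off at the variables \<open>x\<^sub>1, \<dots>, x\<^sub>n\<close> only; for elements of
  \<open>k[x\<^sub>1, \<dots>, x\<^sub>n]\<close> all other exponents are zero.
\<close>

definition supp :: "('n::finite + nat, 'k::zero) mpol \<Rightarrow> (real ^ 'n) set" where
  "supp f = (\<lambda>a. \<chi> i. real (Poly_Mapping.lookup a (Inl i))) ` Poly_Mapping.keys f"

definition Newton_polytope :: "('n::finite + nat, 'k::zero) mpol \<Rightarrow> (real ^ 'n) set" where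
  "Newton_polytope f = convex hull (supp f)"

definition is_intruder :: "('n::finite + nat, 'k::zero) mpol \<Rightarrow> real ^ 'n \<Rightarrow> bool" where
  "is_intruder f v \<longleftrightarrow> v extreme_point_of Newton_polytope f \<and> (\<forall>l. v $ l \<noteq> 0)"


subsection \<open>Actions of the additive group\<close>

text \<open>
  \<open>B[z]\<close> is rendered by univariate polynomials with coefficients in \<open>B\<close>.  The ring
  \<open>B \<otimes> k[z] \<otimes> k[z]\<close> is rendered by polynomials over polynomials over \<open>B\<close>,
  the inner indeterminate being the second tensor factor and the outer one the third.
\<close>

definition is_k_algebra_hom ::
    "('v, 'k::comm_ring_1) mpol set \<Rightarrow> (('v, 'k) mpol \<Rightarrow> ('v, 'k) mpol poly) \<Rightarrow> bool" where
  "is_k_algebra_hom B \<sigma> \<longleftrightarrow>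
     (\<forall>f\<in>B. \<forall>i. coeff (\<sigma> f) i \<in> B) \<and>
     (\<forall>f\<in>B. \<forall>g\<in>B. \<sigma> (f + g) = \<sigma> f + \<sigma> g) \<and>
     (\<forall>f\<in>B. \<forall>g\<in>B. \<sigma> (f * g) = \<sigma> f * \<sigma> g) \<and>
     (\<forall>c. \<sigma> (const_mpol c) = [:const_mpol c:])"

text \<open>The map \<open>\<sigma> \<otimes> id\<close>.\<close>

definition tensor_id :: "('b::comm_ring_1 \<Rightarrow> 'b poly) \<Rightarrow> 'b poly \<Rightarrow> 'b poly poly" where
  "tensor_id \<sigma> p = map_poly \<sigma> p"

text \<open>
  The map \<open>id \<otimes> \<mu>\<close>: the substitution of \<open>z \<otimes> 1 + 1 \<otimes> z\<close> for \<open>z\<close>.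
\<close>

definition id_tensor_mu :: "'b::comm_ring_1 poly \<Rightarrow> 'b poly poly" where
  "id_tensor_mu p = poly (map_poly (\<lambda>b. [:[:b:]:]) p) ([:[:0, 1:]:] + [:0, 1:])"

text \<open>Only the restriction of \<open>\<sigma>\<close> to the ring \<open>B\<close> matters.\<close>

definition is_Ga_action ::
    "('v, 'k::comm_ring_1) mpol set \<Rightarrow> (('v, 'k) mpol \<Rightarrow> ('v, 'k) mpol poly) \<Rightarrow> bool" where
  "is_Ga_action B \<sigma> \<longleftrightarrow>
     is_k_algebra_hom B \<sigma> \<and>
     (\<forall>f\<in>B. poly (\<sigma> f) 0 = f) \<and>
     (\<forall>f\<in>B. tensor_id \<sigma> (\<sigma> f) = id_tensor_mu (\<sigma> f))"

definition Ga_invariants ::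
    "('v, 'k::comm_ring_1) mpol set \<Rightarrow> (('v, 'k) mpol \<Rightarrow> ('v, 'k) mpol poly)
      \<Rightarrow> ('v, 'k) mpol set" where
  "Ga_invariants B \<sigma> = {f \<in> B. \<sigma> f \<in> (\<lambda>b. [:b:]) ` B}"

definition stable_Ga_invariant :: "('n::finite + nat, 'k::comm_ring_1) mpol \<Rightarrow> bool" where
  "stable_Ga_invariant f \<longleftrightarrow>
     f \<in> poly_ring CARD('n) \<and>
     (\<exists>m \<ge> CARD('n). \<exists>\<sigma>. is_Ga_action (poly_ring m) \<sigma> \<and>
        f \<in> Ga_invariants (poly_ring m) \<sigma> \<and>
        \<not> poly_ring CARD('n) \<subseteq> Ga_invariants (poly_ring m) \<sigma>)"

end

theory Submission
  imports Defs
begin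

text \<open>
  Let \<open>v\<close> be an intruder of the invariant \<open>f\<close>.  As a vertex of the Newton polytope, \<open>v\<close> is the unique
  maximum on the support of \<open>f\<close> of some linear form \<open>w\<close>.  Give \<open>x\<^sub>i\<close> the weight \<open>w\<^sub>i\<close> for
  \<open>i \<le> n\<close>, every further variable the weight \<open>0\<close>, and \<open>z\<close> a real weight \<open>\<delta>\<close>, and let \<open>D\<close> be the
  resulting degree on \<open>B[z]\<close>.  Since \<open>B[z]\<close> is a domain, \<open>D\<close> turns products into sums.

  The constant term of \<open>\<sigma>(x\<^sub>i)\<close> in \<open>z\<close> is \<open>x\<^sub>i\<close>, so \<open>D(\<sigma>(x\<^sub>i)) \<ge> w\<^sub>i\<close> for all \<open>\<delta>\<close>.  Suppose that
  some \<open>\<sigma>(x\<^sub>i)\<close> with \<open>i \<le> n\<close> involves \<open>z\<close>.  The largest excess \<open>D(\<sigma>(x\<^sub>i)) - w\<^sub>i\<close> over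
  \<open>i \<le> n\<close> is then a continuous function of \<open>\<delta>\<close> that vanishes for very negative \<open>\<delta>\<close> and tends to
  infinity with \<open>\<delta>\<close>; so, for any prescribed \<open>\<eta> > 0\<close>, a suitable \<open>\<delta>\<close> makes it equal to \<open>\<eta>\<close>.  If \<open>\<eta>\<close> is
  small, the exponent \<open>v\<close> still dominates in \<open>f(\<sigma>(x\<^sub>1), \<dots>, \<sigma>(x\<^sub>n))\<close>, so that
  \<open>D(\<sigma>(f)) = \<Sum> v\<^sub>i D(\<sigma>(x\<^sub>i))\<close>.  All \<open>v\<^sub>i\<close> are positive and at least one of the excesses is, so
  this sum is greater than \<open>\<Sum> v\<^sub>i w\<^sub>i = D(f)\<close>, in contradiction to \<open>\<sigma>(f) = f\<close>.  Hence \<open>\<sigma>\<close> fixes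
  \<open>x\<^sub>1, \<dots>, x\<^sub>n\<close>, and so all of \<open>k[x\<^sub>1, \<dots>, x\<^sub>n]\<close>.

  This is \<open>intruder_imp_variables_fixed\<close>.  The degree \<open>D\<close> is obtained by embedding \<open>B[z]\<close>
  (\<open>embed\<close>) into an algebra whose exponents form a linearly ordered group: the first coordinate of
  an exponent (\<open>weight_exponent\<close>) is its weight, and the others keep different monomials apart.
  There \<open>lead_mult\<close> gives the additivity of \<open>D\<close> (\<open>top_weight\<close>).
\<close>

abbreviation "keys \<equiv> Poly_Mapping.keys"
abbreviation "lookup \<equiv> Poly_Mapping.lookup"
abbreviation "single \<equiv> Poly_Mapping.single"


section \<open>Changing the exponents of a monoid algebra\<close>

lemma poly_mapping_as_sum_of_singles:
  "f = (\<Sum>a\<in>keys f. single a (lookup f a))"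
proof (rule poly_mapping_eqI)
  fix k
  show "lookup f k = lookup
    (\<Sum>a\<in>keys f. single a (lookup f a)) k"
    by (cases "k \<in> keys f")
      (auto simp: lookup_sum lookup_single when_def sum.delta in_keys_iff)
qed

text \<open>
  The pushforward along \<open>e\<close>.  For additive \<open>e\<close> it is the induced homomorphism of monoid algebras.
\<close>

definition relabel :: "('a \<Rightarrow> 'b) \<Rightarrow> ('a \<Rightarrow>\<^sub>0 'k::comm_monoid_add) \<Rightarrow> ('b \<Rightarrow>\<^sub>0 'k)" where
  "relabel e f = (\<Sum>a\<in>keys f. single (e a) (lookup f a))"

lemma relabel_zero [simp]: "relabel e 0 = 0"
  by (simp add: relabel_def)

lemma relabel_single [simp]: "relabel e (single a c) = single (e a) c"
  by (cases "c = 0") (simp_all add: relabel_def)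

lemma relabel_add: "relabel e (f + g) = relabel e f + relabel e g"
  unfolding relabel_def by (rule setsum_keys_plus_distrib) (simp_all add: single_add)

lemma relabel_sum: "relabel e (sum F A) = (\<Sum>i\<in>A. relabel e (F i))"
  by (induction A rule: infinite_finite_induct) (simp_all add: relabel_add)

lemma relabel_mult:
  fixes f g :: "'a::monoid_add \<Rightarrow>\<^sub>0 'k::comm_semiring_1"
  assumes e: "\<And>a b. e (a + b) = e a + (e b :: 'b::monoid_add)"
  shows "relabel e (f * g) = relabel e f * relabel e g"
proof -
  have "f * g = (\<Sum>a\<in>keys f. single a (lookup f a)) * (\<Sum>b\<in>keys g. single b (lookup g b))"
    using poly_mapping_as_sum_of_singles[of f] poly_mapping_as_sum_of_singles[of g] by simp
  then have "f * g = (\<Sum>a\<in>keys f. \<Sum>b\<in>keys g. single (a + b) (lookup f a * lookup g b))"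
    by (simp add: sum_product mult_single)
  then have "relabel e (f * g) = (\<Sum>a\<in>keys f. \<Sum>b\<in>keys g. single (e a + e b) (lookup f a * lookup g b))"
    by (simp add: relabel_sum e)
  also have "\<dots> = relabel e f * relabel e g"
    by (simp add: relabel_def sum_product mult_single)
  finally show ?thesis .
qed

lemma lookup_relabel:
  assumes "inj e"
  shows "lookup (relabel e f) (e a) = lookup f a"
proof -
  have "lookup (relabel e f) (e a) =
      (\<Sum>b\<in>keys f. if b = a then lookup f b else 0)"
    unfolding relabel_def using assms
    by (auto simp: lookup_sum lookup_single when_def inj_eq intro!: sum.cong)
  then show ?thesis by (auto simp: sum.delta' in_keys_iff)
qed

lemma keys_relabel: "keys (relabel e f) \<subseteq> e ` keys f"
  unfolding relabel_def by (rule order_trans[OF keys_sum]) (auto split: if_splits)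

section \<open>Leading exponents and top weights\<close>

definition lead :: "('a::linorder \<Rightarrow>\<^sub>0 'k::zero) \<Rightarrow> 'a" where
  "lead r = Max (keys r)"

lemma lead_in_keys: "r \<noteq> 0 \<Longrightarrow> lead r \<in> keys r"
  unfolding lead_def by (rule Max_in) simp_all

lemma le_lead: "t \<in> keys r \<Longrightarrow> t \<le> lead r"
  unfolding lead_def by simp

lemma lookup_mult_group:
  fixes r s :: "'a::ab_group_add \<Rightarrow>\<^sub>0 'k::semiring_0"
  shows "lookup (r * s) t =
    (\<Sum>a\<in>keys r. lookup r a * lookup s (t - a))"
proof -
  have "(t = a + q) = (q = t - a)" for a q by (auto simp: algebra_simps)
  then have "lookup (r * s) t =
      (\<Sum>a. lookup r a * lookup s (t - a))"
    by (simp add: lookup_mult)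
  also have "\<dots> = (\<Sum>a\<in>keys r. lookup r a * lookup s (t - a))"
    by (rule Sum_any.expand_superset) (auto simp: in_keys_iff)
  finally show ?thesis .
qed

text \<open>
  The exponent \<open>lead r + lead s\<close> arises in only one way as a sum of an exponent of \<open>r\<close> and one of
  \<open>s\<close>, so its coefficient is the product of the two leading coefficients, and that is nonzero.
\<close>

lemma lead_mult:
  fixes r s :: "'a::linordered_ab_group_add \<Rightarrow>\<^sub>0 'k::idom"
  assumes "r \<noteq> 0" "s \<noteq> 0"
  shows "lead (r * s) = lead r + lead s"
proof -
  have "lookup (r * s) (lead r + lead s) =
    (\<Sum>a\<in>keys r. if a = lead r then lookup r (lead r) * lookup s (lead s) else 0)"
    unfolding lookup_mult_group
  proof (rule sum.cong[OF refl])
    fix a assume a: "a \<in> keys r"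
    show "lookup r a * lookup s (lead r + lead s - a) =
      (if a = lead r then lookup r (lead r) * lookup s (lead s) else 0)"
    proof (cases "a = lead r")
      case False
      then have "a < lead r" using le_lead[OF a] by simp
      then have "lead s < lead r + lead s - a" by (simp add: algebra_simps)
      then have "lead r + lead s - a \<notin> keys s"
        using le_lead[of _ s] leD by blast
      with False show ?thesis by (simp add: in_keys_iff)
    qed simp
  qed
  also have "\<dots> = lookup r (lead r) * lookup s (lead s)"
    using lead_in_keys[OF assms(1)] by (simp add: sum.delta)
  also have "\<dots> \<noteq> 0"
    using lead_in_keys[OF assms(1)] lead_in_keys[OF assms(2)] by (simp add: in_keys_iff)
  finally have "lead r + lead s \<in> keys (r * s)" by (simp add: in_keys_iff)
  moreover have "t \<le> lead r + lead s" if "t \<in> keys (r * s)" for t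
    using that keys_mult[of r s] by (auto intro!: add_mono le_lead)
  ultimately show ?thesis unfolding lead_def[of "r * s"] by (intro Max_eqI) auto
qed

lemma lookup_scale:
  fixes r :: "'a::ab_group_add \<Rightarrow>\<^sub>0 'k::semiring_1"
  shows "lookup (single 0 c * r) t = c * lookup r t"
  by (cases "c = 0") (simp_all add: lookup_mult_group)

text \<open>
  Exponents in \<open>nat \<Rightarrow>\<^sub>0 real\<close> are compared lexicographically, position \<open>0\<close> first.  So position
  \<open>0\<close> can carry a real weight, possibly equal for several monomials, while the later positions
  make the order total.  The leading exponent then has the largest weight, and it is a single
  monomial, which makes the weight of a product the sum of the weights.
\<close>

definition top_weight :: "((nat \<Rightarrow>\<^sub>0 real) \<Rightarrow>\<^sub>0 'k::zero) \<Rightarrow> real" where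
  "top_weight r = lookup (lead r) 0"

lemma lookup_0_mono:
  fixes s t :: "nat \<Rightarrow>\<^sub>0 real"
  assumes "s \<le> t"
  shows "lookup s 0 \<le> lookup t 0"
proof (cases "s = t")
  case False
  with assms have "less_fun (lookup s) (lookup t)"
    by (auto simp only: less_eq_poly_mapping.rep_eq poly_mapping_eq_iff)
  then obtain k where "lookup s k < lookup t k"
      "\<And>k'. k' < k \<Longrightarrow> lookup s k' = lookup t k'"
    unfolding less_fun_def by blast
  then show ?thesis by (cases "k = 0") auto
qed simp

lemma le_top_weight: "t \<in> keys r \<Longrightarrow> lookup t 0 \<le> top_weight r"
  unfolding top_weight_def by (intro lookup_0_mono le_lead)

lemma top_weight_mult:
  fixes r s :: "(nat \<Rightarrow>\<^sub>0 real) \<Rightarrow>\<^sub>0 'k::idom"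
  assumes "r \<noteq> 0" "s \<noteq> 0"
  shows "top_weight (r * s) = top_weight r + top_weight s"
  by (simp add: top_weight_def lead_mult assms lookup_add)

lemma top_weight_one: "top_weight (1 :: (nat \<Rightarrow>\<^sub>0 real) \<Rightarrow>\<^sub>0 'k::idom) = 0"
  by (simp add: top_weight_def lead_def)

lemma top_weight_power:
  fixes r :: "(nat \<Rightarrow>\<^sub>0 real) \<Rightarrow>\<^sub>0 'k::idom"
  assumes "r \<noteq> 0"
  shows "top_weight (r ^ n) = real n * top_weight r"
  by (induction n) (simp_all add: top_weight_one top_weight_mult assms algebra_simps)

lemma top_weight_prod:
  fixes F :: "'i \<Rightarrow> (nat \<Rightarrow>\<^sub>0 real) \<Rightarrow>\<^sub>0 'k::idom"
  assumes "finite A" "\<And>i. i \<in> A \<Longrightarrow> F i \<noteq> 0"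
  shows "top_weight (prod F A) = (\<Sum>i\<in>A. top_weight (F i))"
  using assms
  by (induction A rule: finite_induct) (simp_all add: top_weight_one top_weight_mult)

section \<open>Ring homomorphisms on polynomials are substitutions\<close>

definition var :: "'v \<Rightarrow> ('v, 'k::comm_ring_1) mpol" where
  "var v = single (single v 1) 1"

lemma one_mpol: "1 = (const_mpol 1 :: ('v, 'k::comm_ring_1) mpol)"
  by (simp add: const_mpol_def)

lemma single_in_polys_in:
  "keys a \<subseteq> V \<Longrightarrow> single a c \<in> polys_in V"
  by (auto simp: polys_in_def)

lemma polys_in_sum:
  fixes F :: "'i \<Rightarrow> ('v, 'k::comm_ring_1) mpol"
  assumes "\<And>i. i \<in> A \<Longrightarrow> F i \<in> polys_in V"
  shows "sum F A \<in> polys_in V"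
  unfolding polys_in_def
proof (intro CollectI ballI)
  fix a assume "a \<in> keys (sum F A)"
  then obtain i where "i \<in> A" "a \<in> keys (F i)" using keys_sum[of F A] by blast
  then show "keys a \<subseteq> V" using assms[of i] by (simp add: polys_in_def)
qed

text \<open>
  This serves twice: it expands \<open>\<sigma>(f)\<close> in powers of the \<open>\<sigma>(x\<^sub>i)\<close>, and it shows that two
  homomorphisms which agree on constants and variables agree everywhere.  The laws are required on
  \<open>polys_in V\<close> only, because nothing is known about \<open>\<sigma>\<close> outside \<open>B\<close>.
\<close>

lemma hom_as_substitution:
  fixes h :: "('v, 'k::comm_ring_1) mpol \<Rightarrow> 'r::comm_ring_1"
  assumes add: "\<And>f g. f \<in> polys_in V \<Longrightarrow> g \<in> polys_in V \<Longrightarrow> h (f + g) = h f + h g"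
    and mult: "\<And>f g. f \<in> polys_in V \<Longrightarrow> g \<in> polys_in V \<Longrightarrow> h (f * g) = h f * h g"
    and one: "h 1 = 1"
    and f: "f \<in> polys_in V"
  shows "h f = (\<Sum>a\<in>keys f. h (const_mpol (lookup f a)) *
    (\<Prod>v\<in>keys a. h (var v) ^ lookup a v))"
proof -
  have zero: "h 0 = 0" using add[of 0 0] by (simp add: polys_in_def)
  have hsum: "h (sum F A) = (\<Sum>i\<in>A. h (F i))"
    if "\<And>i. i \<in> A \<Longrightarrow> F i \<in> polys_in V" for F and A :: "('v \<Rightarrow>\<^sub>0 nat) set"
    using that
    by (induction A rule: infinite_finite_induct) (auto simp: zero add polys_in_sum)
  have power: "h (single (single v n) 1) = h (var v) ^ n" if "v \<in> V" for v n
  proof (induction n)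
    case 0
    then show ?case by (simp add: one)
  next
    case (Suc n)
    have "(single (single v (Suc n)) 1 :: ('v, 'k) mpol) =
        var v * single (single v n) 1"
      by (simp add: var_def mult_single single_add[symmetric])
    moreover have "(var v :: ('v, 'k) mpol) \<in> polys_in V"
        "(single (single v n) 1 :: ('v, 'k) mpol) \<in> polys_in V"
      using that unfolding var_def by (auto intro!: single_in_polys_in split: if_splits)
    ultimately show ?case using Suc by (simp add: mult)
  qed
  have monomial: "h (single (\<Sum>v\<in>A. single v (n v)) 1) = (\<Prod>v\<in>A. h (var v) ^ n v)"
    if "finite A" "A \<subseteq> V" for A and n :: "'v \<Rightarrow> nat"
    using that
  proof (induction A rule: finite_induct)
    case empty
    then show ?case by (simp add: one)
  next
    case (insert x A)
    let ?s = "\<Sum>v\<in>A. single v (n v)"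
    have "keys ?s \<subseteq> V"
      using insert.prems by (intro order_trans[OF keys_sum]) (auto split: if_splits)
    then have "(single ?s 1 :: ('v, 'k) mpol) \<in> polys_in V"
      by (rule single_in_polys_in)
    moreover have "(single (single x (n x)) 1 :: ('v, 'k) mpol) \<in> polys_in V"
      using insert.prems by (auto intro!: single_in_polys_in split: if_splits)
    moreover have "single (\<Sum>v\<in>insert x A. single v (n v)) (1::'k) =
        single (single x (n x)) 1 * single ?s 1"
      using insert.hyps by (simp add: mult_single)
    ultimately show ?case using insert power by (simp add: mult)
  qed
  have split: "single a c = const_mpol c * single a (1::'k)"
    for a :: "'v \<Rightarrow>\<^sub>0 nat" and c
    by (simp add: const_mpol_def mult_single)
  have keys: "keys a \<subseteq> V" if "a \<in> keys f" for a
    using f that by (auto simp: polys_in_def)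
  have "h f = h (\<Sum>a\<in>keys f. single a (lookup f a))"
    using poly_mapping_as_sum_of_singles[of f] by simp
  also have "\<dots> = (\<Sum>a\<in>keys f. h (single a (lookup f a)))"
    using keys by (intro hsum single_in_polys_in)
  also have "\<dots> = (\<Sum>a\<in>keys f. h (const_mpol (lookup f a)) *
    (\<Prod>v\<in>keys a. h (var v) ^ lookup a v))"
  proof (rule sum.cong[OF refl])
    fix a assume a: "a \<in> keys f"
    have "h (single a (lookup f a)) =
        h (const_mpol (lookup f a)) * h (single a 1)"
      unfolding split[of a "lookup f a"]
      by (rule mult) (auto simp: const_mpol_def intro!: single_in_polys_in dest!: keys[OF a, THEN subsetD])
    also have "h (single a 1) =
        (\<Prod>v\<in>keys a. h (var v) ^ lookup a v)"
      using monomial[of "keys a" "lookup a"] keys[OF a]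
        poly_mapping_as_sum_of_singles[of a] by simp
    finally show "h (single a (lookup f a)) =
        h (const_mpol (lookup f a)) *
        (\<Prod>v\<in>keys a. h (var v) ^ lookup a v)" .
  qed
  finally show ?thesis .
qed

section \<open>Embedding \<open>B[z]\<close> into a monoid algebra\<close>

text \<open>
  The substitution \<open>x\<^sup>a \<mapsto> t\<^bsup>E a 0\<^esup>\<close>, \<open>z \<mapsto> t\<^bsup>E 0 1\<^esup>\<close>.  For additive \<open>E\<close> it sends
  \<open>x\<^sup>a z\<^sup>j\<close> to \<open>t\<^bsup>E a j\<^esup>\<close>; evaluating a univariate polynomial makes multiplicativity an easy
  induction, and \<open>embed_as_sum\<close> recovers the monomials.
\<close>

definition embed ::
    "('a::comm_monoid_add \<Rightarrow> nat \<Rightarrow> 'g::ab_group_add) \<Rightarrow> ('a \<Rightarrow>\<^sub>0 'k::comm_ring_1) poly \<Rightarrow> ('g \<Rightarrow>\<^sub>0 'k)" where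
  "embed E q = poly (map_poly (relabel (\<lambda>a. E a 0)) q) (single (E 0 1) 1)"

lemma embed_pCons:
  "embed E (pCons c q) = relabel (\<lambda>a. E a 0) c + single (E 0 1) 1 * embed E q"
  by (simp add: embed_def map_poly_pCons)

lemma embed_0 [simp]: "embed E 0 = 0"
  by (simp add: embed_def)

lemma embed_add: "embed E (p + q) = embed E p + embed E q"
proof (induction p q rule: poly_induct2)
  case (pCons a p b q)
  then show ?case by (simp add: embed_pCons relabel_add algebra_simps)
qed simp

lemma embed_mult:
  assumes E: "\<And>a b j k. E (a + b) (j + k) = E a j + E b k"
  shows "embed E (p * q) = embed E p * embed E q"
proof -
  have E0: "E (a + b) 0 = E a 0 + E b 0" for a b
    using E[of a b 0 0] by simp
  have smult: "embed E (smult c q) = relabel (\<lambda>a. E a 0) c * embed E q" for c q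
    by (induction q) (simp_all add: embed_pCons relabel_mult E0 algebra_simps)
  have shift: "embed E (pCons 0 q) = single (E 0 1) 1 * embed E q" for q
    by (simp add: embed_pCons)
  show ?thesis
  proof (induction p)
    case (pCons c p)
    then show ?case
      by (simp add: embed_add smult shift embed_pCons[of E c p] algebra_simps)
  qed simp
qed

lemma embed_as_sum:
  assumes E: "\<And>a b j k. E (a + b) (j + k) = E a j + E b k"
  shows "embed E q = (\<Sum>j\<le>degree q. relabel (\<lambda>a. E a j) (coeff q j))"
proof -
  have power: "single (E 0 1) 1 ^ j = single (E 0 j) (1::'c)" for j
  proof (induction j)
    case 0
    have "E 0 0 = 0" using E[of 0 0 0 0] by simp
    then show ?case by simp
  next
    case (Suc j)
    then show ?case using E[of 0 0 1 j] by (simp add: mult_single)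
  qed
  have shift: "relabel (\<lambda>a. E a 0) c * single (E 0 j) 1 = relabel (\<lambda>a. E a j) c"
    for c :: "'a \<Rightarrow>\<^sub>0 'c" and j
  proof -
    have "E a 0 + E 0 j = E a j" for a using E[of a 0 0 j] by simp
    then show ?thesis by (simp add: relabel_def sum_distrib_right mult_single)
  qed
  let ?M = "map_poly (relabel (\<lambda>a. E a 0)) q"
  have "embed E q = (\<Sum>j\<le>degree ?M. coeff ?M j * single (E 0 1) 1 ^ j)"
    unfolding embed_def by (rule poly_altdef)
  also have "\<dots> = (\<Sum>j\<le>degree q. coeff ?M j * single (E 0 1) 1 ^ j)"
  proof (rule sum.mono_neutral_left)
    have "degree ?M \<le> degree q"
      by (rule degree_le) (simp add: coeff_map_poly coeff_eq_0)
    then show "{..degree ?M} \<subseteq> {..degree q}" by simp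
  qed (auto intro!: le_degree)
  finally show ?thesis by (simp only: coeff_map_poly relabel_zero power shift)
qed

text \<open>
  Injectivity of \<open>E\<close> on pairs keeps the monomials \<open>x\<^sup>a z\<^sup>j\<close> apart, so no terms cancel and the degree
  of an image can be read off from the coefficients.
\<close>

lemma lookup_embed:
  assumes E: "\<And>a b j k. E (a + b) (j + k) = E a j + E b k"
    and inj: "\<And>a b j k. E a j = E b k \<Longrightarrow> a = b \<and> j = k"
  shows "lookup (embed E q) (E a j) = lookup (coeff q j) a"
proof -
  have "lookup (relabel (\<lambda>a. E a i) (coeff q i)) (E a j) =
      (if i = j then lookup (coeff q j) a else 0)" for i
  proof (cases "i = j")
    case True
    have "inj (\<lambda>a. E a j)" using inj by (auto intro: injI)
    with True show ?thesis using lookup_relabel[of "\<lambda>a. E a j"] by simp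
  next
    case False
    then have "E a j \<notin> (\<lambda>b. E b i) ` keys (coeff q i)" using inj by blast
    then have "E a j \<notin> keys (relabel (\<lambda>a. E a i) (coeff q i))"
      using keys_relabel[of "\<lambda>a. E a i" "coeff q i"] by blast
    with False show ?thesis by (simp add: in_keys_iff)
  qed
  then show ?thesis
    by (auto simp: embed_as_sum[OF E] lookup_sum coeff_eq_0 sum.delta)
qed

lemma keys_embed:
  assumes E: "\<And>a b j k. E (a + b) (j + k) = E a j + E b k"
    and t: "t \<in> keys (embed E q)"
  obtains a j where "t = E a j" "a \<in> keys (coeff q j)"
proof -
  from t have "(\<Sum>j\<le>degree q. lookup (relabel (\<lambda>a. E a j) (coeff q j)) t) \<noteq> 0"
    by (simp add: in_keys_iff embed_as_sum[OF E] lookup_sum)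
  then obtain j where "lookup (relabel (\<lambda>a. E a j) (coeff q j)) t \<noteq> 0"
    by (meson sum.neutral)
  then have "t \<in> (\<lambda>a. E a j) ` keys (coeff q j)"
    using keys_relabel[of "\<lambda>a. E a j" "coeff q j"] by (auto simp: in_keys_iff)
  with that show ?thesis by blast
qed

section \<open>Exponents refined by weights\<close>

definition exponent_vector :: "('n::finite + nat \<Rightarrow>\<^sub>0 nat) \<Rightarrow> real ^ 'n" where
  "exponent_vector a = (\<chi> i. real (lookup a (Inl i)))"

lemma exponent_vector_add: "exponent_vector (a + b) = exponent_vector a + exponent_vector b"
  by (simp add: exponent_vector_def vec_eq_iff lookup_add)

lemma supp_eq: "supp f = exponent_vector ` keys f"
  by (simp add: supp_def exponent_vector_def)

text \<open>
  The exponent vector moved to the positions from \<open>2\<close> on: position \<open>0\<close> is kept for the weight and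
  position \<open>1\<close> for the exponent of \<open>z\<close>.
\<close>

definition tie_breaker :: "('v::countable \<Rightarrow>\<^sub>0 nat) \<Rightarrow> (nat \<Rightarrow>\<^sub>0 real)" where
  "tie_breaker a = (\<Sum>v\<in>keys a. single (to_nat v + 2) (real (lookup a v)))"

lemma tie_breaker_add: "tie_breaker (a + b) = tie_breaker a + tie_breaker b"
  unfolding tie_breaker_def by (rule setsum_keys_plus_distrib) (simp_all add: single_add)

lemma lookup_tie_breaker [simp]:
  "lookup (tie_breaker a) 0 = 0"
  "lookup (tie_breaker a) (Suc 0) = 0"
  by (simp_all add: tie_breaker_def lookup_sum lookup_single when_def)

lemma lookup_tie_breaker_var:
  "lookup (tie_breaker a) (to_nat v + 2) = real (lookup a v)"
proof -
  have "lookup (tie_breaker a) (to_nat v + 2) =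
      (\<Sum>u\<in>keys a. if u = v then real (lookup a u) else 0)"
    unfolding tie_breaker_def
    by (auto simp: lookup_sum lookup_single when_def intro!: sum.cong)
  then show ?thesis by (auto simp: sum.delta in_keys_iff)
qed

definition weight_exponent ::
    "real ^ 'n \<Rightarrow> real \<Rightarrow> ('n::finite + nat \<Rightarrow>\<^sub>0 nat) \<Rightarrow> nat \<Rightarrow> (nat \<Rightarrow>\<^sub>0 real)" where
  "weight_exponent w \<delta> a j =
     single 0 (w \<bullet> exponent_vector a + real j * \<delta>) +
     single 1 (real j) + tie_breaker a"

lemma weight_exponent_add:
  "weight_exponent w \<delta> (a + b) (j + k) = weight_exponent w \<delta> a j + weight_exponent w \<delta> b k"
  by (simp add: weight_exponent_def exponent_vector_add tie_breaker_add inner_add_right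
      single_add algebra_simps)

lemma lookup_weight_exponent_0:
  "lookup (weight_exponent w \<delta> a j) 0 = w \<bullet> exponent_vector a + real j * \<delta>"
  by (simp add: weight_exponent_def lookup_add lookup_single)

lemma weight_exponent_inj:
  assumes "weight_exponent w \<delta> a j = weight_exponent w \<delta> b k"
  shows "a = b \<and> j = k"
proof
  have "lookup (weight_exponent w \<delta> c i) (to_nat v + 2) = real (lookup c v)" for c i v
    unfolding weight_exponent_def lookup_add lookup_tie_breaker_var by (simp add: lookup_single)
  then have "real (lookup a v) = real (lookup b v)" for v
    using assms by metis
  then show "a = b" by (simp add: poly_mapping_eqI)
  have "lookup (weight_exponent w \<delta> c i) 1 = real i" for c i
    by (simp add: weight_exponent_def lookup_add lookup_single)
  then have "real j = real k" using assms by metis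
  then show "j = k" by simp
qed

section \<open>Separating a vertex of a polytope\<close>

text \<open>
  An extreme point \<open>v\<close> can be removed from the hull without losing convexity, so \<open>v\<close> lies outside the
  hull of the other points.  That hull is compact, because \<open>S\<close> is finite, and a hyperplane
  separates \<open>v\<close> from it strictly.
\<close>

lemma extreme_point_strictly_exposed:
  fixes S :: "('a::euclidean_space) set"
  assumes "finite S" "v extreme_point_of (convex hull S)"
  obtains w where "\<And>s. s \<in> S \<Longrightarrow> s \<noteq> v \<Longrightarrow> w \<bullet> s < w \<bullet> v"
proof -
  have "v \<notin> convex hull (S - {v})"
  proof
    assume v: "v \<in> convex hull (S - {v})"
    have "convex (convex hull S - {v})"
      using assms(2) by (simp add: extreme_point_of_stillconvex)
    then have "convex hull (S - {v}) \<subseteq> convex hull S - {v}"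
      using hull_subset[of S convex] by (intro hull_minimal) auto
    with v show False by blast
  qed
  moreover have "closed (convex hull (S - {v}))"
    using assms(1) by (simp add: finite_imp_compact_convex_hull compact_imp_closed)
  ultimately obtain u b where u: "u \<bullet> v < b" "\<And>s. s \<in> convex hull (S - {v}) \<Longrightarrow> b < u \<bullet> s"
    using separating_hyperplane_closed_point[OF convex_convex_hull] by metis
  have "(- u) \<bullet> s < (- u) \<bullet> v" if "s \<in> S" "s \<noteq> v" for s
  proof -
    have "s \<in> convex hull (S - {v})" using that by (simp add: hull_inc)
    then show ?thesis using u by fastforce
  qed
  then show ?thesis by (rule that)
qed

text \<open>
  Each of the finitely many inequalities holds for all small positive \<open>\<eta>\<close>, since its left side tends
  to \<open>0\<close> with \<open>\<eta>\<close>.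
\<close>

lemma uniform_small_factor:
  fixes c g :: "'a \<Rightarrow> real"
  assumes "finite A" "\<And>a. a \<in> A \<Longrightarrow> 0 < g a"
  obtains \<eta> where "0 < \<eta>" "\<And>a. a \<in> A \<Longrightarrow> \<eta> * c a < g a"
proof -
  have "\<forall>\<^sub>F \<eta> in at_right (0::real). \<eta> * c a < g a" if "a \<in> A" for a
  proof -
    have "((\<lambda>\<eta>. \<eta> * c a) \<longlongrightarrow> 0 * c a) (at_right 0)"
      by (intro tendsto_intros)
    then show ?thesis using assms(2)[OF that] by (auto dest: order_tendstoD(2))
  qed
  then have "\<forall>\<^sub>F \<eta> in at_right (0::real). \<forall>a\<in>A. \<eta> * c a < g a"
    using assms(1) by (simp add: eventually_ball_finite_distrib)
  then have "\<forall>\<^sub>F \<eta> in at_right (0::real). 0 < \<eta> \<and> (\<forall>a\<in>A. \<eta> * c a < g a)"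
    using eventually_at_right_less[of 0] by eventually_elim auto
  then obtain \<eta> where "0 < \<eta> \<and> (\<forall>a\<in>A. \<eta> * c a < g a)"
    using eventually_happens' trivial_limit_at_right_real by blast
  with that show ?thesis by blast
qed

section \<open>Invariants with an intruder\<close>

text \<open>
  The order of the choices matters.  The finitely many gaps between \<open>w \<bullet> v\<close> and the values of \<open>w\<close> on
  the rest of the support determine how small \<open>\<eta>\<close> has to be, and only then is \<open>\<delta>\<close> adjusted so that
  the largest excess is \<open>\<eta>\<close>.  An exponent \<open>a\<close> contributes a term of weight between \<open>w \<bullet> a\<close> and
  \<open>w \<bullet> a + \<eta> \<bar>a\<bar>\<close>, where \<open>\<bar>a\<bar>\<close> is the sum of its entries, so the term of \<open>v\<close> stays on top.  Its
  weight is strictly greater than \<open>w \<bullet> v\<close>, because \<open>v\<close> has a nonzero entry at the variable with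
  the largest excess; this is where \<open>v\<close> must be an intruder and not just a vertex.
\<close>

lemma intruder_imp_variables_fixed:
  fixes f :: "('n::finite + nat, 'k::idom) mpol"
  assumes add: "\<And>f g. f \<in> polys_in (range Inl) \<Longrightarrow> g \<in> polys_in (range Inl) \<Longrightarrow> \<sigma> (f + g) = \<sigma> f + \<sigma> g"
    and mult: "\<And>f g. f \<in> polys_in (range Inl) \<Longrightarrow> g \<in> polys_in (range Inl) \<Longrightarrow> \<sigma> (f * g) = \<sigma> f * \<sigma> g"
    and const: "\<And>c. \<sigma> (const_mpol c) = [:const_mpol c:]"
    and start: "\<And>i. coeff (\<sigma> (var (Inl i))) 0 = var (Inl i)"
    and f: "f \<in> polys_in (range Inl)"
    and fixed: "\<sigma> f = [:f:]"
    and intruder: "is_intruder f v"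
  shows "\<sigma> (var (Inl i)) = [:var (Inl i):]"
proof (rule ccontr)
  assume moved: "\<sigma> (var (Inl i)) \<noteq> [:var (Inl i):]"
  let ?x = "\<lambda>i. var (Inl i) :: ('n + nat, 'k) mpol"
  let ?e = "exponent_vector :: ('n + nat \<Rightarrow>\<^sub>0 nat) \<Rightarrow> real ^ 'n"
  have extreme: "v extreme_point_of (convex hull (?e ` keys f))" and v_nz: "v $ l \<noteq> 0" for l
    using intruder by (auto simp: is_intruder_def Newton_polytope_def supp_eq)
  from extreme have "v \<in> ?e ` keys f" by (rule extreme_point_of_convex_hull)
  then obtain a0 where a0: "a0 \<in> keys f" "v = ?e a0" by blast
  obtain w where "\<And>s. s \<in> ?e ` keys f \<Longrightarrow> s \<noteq> v \<Longrightarrow> w \<bullet> s < w \<bullet> v"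
    using extreme_point_strictly_exposed[OF _ extreme] by auto
  \<comment> \<open>Only one monomial of \<open>f\<close> lies over \<open>v\<close>, because the variables \<open>Inr j\<close> do not occur in \<open>f\<close>.\<close>
  moreover have "?e a \<noteq> v" if "a \<in> keys f" "a \<noteq> a0" for a
  proof
    assume "?e a = v"
    then have "lookup a (Inl i) = lookup a0 (Inl i)" for i
      unfolding a0(2) by (simp add: exponent_vector_def vec_eq_iff)
    moreover have "lookup b (Inr j) = 0" if "b \<in> keys f" for b j
      using f that by (force simp: polys_in_def in_keys_iff)
    ultimately have "lookup a u = lookup a0 u" for u
      using that(1) a0(1) by (cases u) simp_all
    then show False using that(2) by (simp add: poly_mapping_eqI)
  qed
  ultimately have w: "w \<bullet> ?e a < w \<bullet> v" if "a \<in> keys f" "a \<noteq> a0" for a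
    using that by blast
  obtain \<eta> where \<eta>: "0 < \<eta>"
    and "\<And>a. a \<in> keys f - {a0} \<Longrightarrow> \<eta> * (\<Sum>i\<in>UNIV. real (lookup a (Inl i))) < w \<bullet> v - w \<bullet> ?e a"
    using uniform_small_factor[of "keys f - {a0}" "\<lambda>a. w \<bullet> v - w \<bullet> ?e a"
        "\<lambda>a. \<Sum>i\<in>UNIV. real (lookup a (Inl i))"] w by auto
  then have gap: "w \<bullet> ?e a + \<eta> * (\<Sum>i\<in>UNIV. real (lookup a (Inl i))) < w \<bullet> v"
    if "a \<in> keys f" "a \<noteq> a0" for a using that by fastforce

  \<comment> \<open>A monomial \<open>x\<^sup>b z\<^sup>j\<close> of \<open>\<sigma>(x\<^sub>i)\<close> with \<open>j \<ge> 1\<close> reaches the weight \<open>w\<^sub>i + \<eta>\<close> exactly when \<open>\<delta>\<close> is its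
    slope.  The least slope is therefore the \<open>\<delta>\<close> at which the largest excess is \<open>\<eta>\<close>.\<close>
  define T where "T = (SIGMA i:UNIV. SIGMA j:{1..degree (\<sigma> (?x i))}. keys (coeff (\<sigma> (?x i)) j))"
  define slope where "slope = (\<lambda>(i, j, b). (w $ i + \<eta> - w \<bullet> ?e b) / real j)"
  define \<delta> where "\<delta> = Min (slope ` T)"
  have T_iff: "(i, j, b) \<in> T \<longleftrightarrow> 1 \<le> j \<and> b \<in> keys (coeff (\<sigma> (?x i)) j)" for i j b
    by (cases "coeff (\<sigma> (?x i)) j = 0") (auto simp: T_def le_degree)
  have "finite T" unfolding T_def by auto
  \<comment> \<open>A moved variable has a coefficient at a positive power of \<open>z\<close>.\<close>
  have "\<exists>j b. (i, j, b) \<in> T"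
  proof (rule ccontr)
    assume "\<not> ?thesis"
    then have "coeff (\<sigma> (?x i)) j = 0" if "1 \<le> j" for j
      using that T_iff keys_eq_empty by blast
    then have "coeff (\<sigma> (?x i)) j = coeff [:?x i:] j" for j
      using start[of i] by (cases j) auto
    with moved show False by (simp add: poly_eq_iff)
  qed
  then have "T \<noteq> {}" by auto
  have \<delta>_le: "w \<bullet> ?e b + real j * \<delta> \<le> w $ i + \<eta>" if "(i, j, b) \<in> T" for i j b
  proof -
    have "\<delta> \<le> slope (i, j, b)" unfolding \<delta>_def using \<open>finite T\<close> that by simp
    moreover have "0 < real j" using that T_iff by auto
    ultimately show ?thesis by (simp add: slope_def field_simps)
  qed
  have "\<delta> \<in> slope ` T" unfolding \<delta>_def using \<open>finite T\<close> \<open>T \<noteq> {}\<close> by (intro Min_in) auto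
  then obtain i0 j0 b0 where T0: "(i0, j0, b0) \<in> T" and \<delta>_eq: "\<delta> = slope (i0, j0, b0)"
    by auto
  have "0 < real j0" using T0 T_iff by auto
  then have \<delta>_eq: "w \<bullet> ?e b0 + real j0 * \<delta> = w $ i0 + \<eta>"
    unfolding \<delta>_eq by (simp add: slope_def)

  let ?E = "weight_exponent w \<delta>"
  let ?\<psi> = "embed ?E :: ('n + nat, 'k) mpol poly \<Rightarrow> _"
  define p where "p = (\<lambda>i. ?\<psi> (\<sigma> (?x i)))"
  define d where "d = (\<lambda>i. top_weight (p i))"
  have in_keys_p: "?E b j \<in> keys (p i) \<longleftrightarrow> b \<in> keys (coeff (\<sigma> (?x i)) j)" for i j b
    unfolding p_def in_keys_iff by (simp add: lookup_embed weight_exponent_add weight_exponent_inj)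
  have e_var: "w \<bullet> ?e (single (Inl i) 1) = w $ i" for i
    by (simp add: exponent_vector_def inner_vec_def lookup_single when_def if_distrib cong: if_cong)
  have x_key: "?E (single (Inl i) 1) 0 \<in> keys (p i)" for i
    unfolding in_keys_p start by (simp add: var_def)
  then have p_nz: "p i \<noteq> 0" for i by (metis keys_zero empty_iff)
  have d_ge: "w $ i \<le> d i" for i
    using le_top_weight[OF x_key[of i]] unfolding lookup_weight_exponent_0 e_var d_def by simp
  have d_le: "d i \<le> w $ i + \<eta>" for i
  proof -
    have "lead (p i) \<in> keys (?\<psi> (\<sigma> (?x i)))"
      using lead_in_keys[OF p_nz[of i]] by (simp only: p_def)
    then obtain b j where t: "lead (p i) = ?E b j" "b \<in> keys (coeff (\<sigma> (?x i)) j)"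
      by (rule keys_embed[OF weight_exponent_add])
    have "d i = w \<bullet> ?e b + real j * \<delta>"
      unfolding d_def top_weight_def t(1) lookup_weight_exponent_0 ..
    also have "\<dots> \<le> w $ i + \<eta>"
    proof (cases "j = 0")
      case True
      with t(2) have "b \<in> keys (?x i)" by (simp only: start)
      then have "b = single (Inl i) 1" by (simp add: var_def)
      with True \<eta> show ?thesis using e_var[of i] by simp
    next
      case False
      with t(2) show ?thesis by (intro \<delta>_le) (simp add: T_iff)
    qed
    finally show ?thesis .
  qed
  have d_i0: "w $ i0 + \<eta> \<le> d i0"
  proof -
    have "?E b0 j0 \<in> keys (p i0)" using T0 by (simp add: in_keys_p T_iff)
    then show ?thesis
      using le_top_weight lookup_weight_exponent_0 \<delta>_eq unfolding d_def by metis
  qed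

  define P where "P = (\<lambda>a :: 'n + nat \<Rightarrow>\<^sub>0 nat. \<Prod>i\<in>UNIV. p i ^ lookup a (Inl i))"
  have P_nz: "P a \<noteq> 0" for a unfolding P_def by (simp add: p_nz)
  have top_P: "top_weight (P a) = (\<Sum>i\<in>UNIV. real (lookup a (Inl i)) * d i)" for a
    unfolding P_def d_def by (simp add: top_weight_prod top_weight_power p_nz)
  have inner_e: "w \<bullet> ?e a = (\<Sum>i\<in>UNIV. real (lookup a (Inl i)) * w $ i)" for a
    by (simp add: exponent_vector_def inner_vec_def mult.commute)
  have P_le: "top_weight (P a) \<le> w \<bullet> ?e a + \<eta> * (\<Sum>i\<in>UNIV. real (lookup a (Inl i)))" for a
  proof -
    have "top_weight (P a) \<le> (\<Sum>i\<in>UNIV. real (lookup a (Inl i)) * (w $ i + \<eta>))"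
      unfolding top_P by (intro sum_mono mult_left_mono d_le) simp
    then show ?thesis
      by (simp add: inner_e sum.distrib sum_distrib_left algebra_simps)
  qed
  have P_a0: "w \<bullet> v < top_weight (P a0)"
  proof -
    have "0 < lookup a0 (Inl i0)"
      using v_nz[of i0] by (simp add: a0(2) exponent_vector_def)
    moreover have "w $ i0 < d i0" using d_i0 \<eta> by simp
    ultimately have "(\<Sum>i\<in>UNIV. real (lookup a0 (Inl i)) * w $ i) <
        (\<Sum>i\<in>UNIV. real (lookup a0 (Inl i)) * d i)"
      by (intro sum_strict_mono_ex1) (auto intro!: mult_left_mono d_ge exI[of _ i0])
    then show ?thesis unfolding top_P a0(2) inner_e .
  qed

  have \<psi>_const: "?\<psi> [:g:] = relabel (\<lambda>a. ?E a 0) g" for g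
    by (simp add: embed_pCons)
  have E_0: "?E 0 0 = 0" using weight_exponent_add[of w \<delta> 0 0 0 0] by simp
  have const': "?\<psi> (\<sigma> (const_mpol c)) = single 0 c" for c
    unfolding const \<psi>_const by (simp add: const_mpol_def E_0)
  have "?\<psi> (\<sigma> f) = (\<Sum>a\<in>keys f. ?\<psi> (\<sigma> (const_mpol (lookup f a))) *
      (\<Prod>u\<in>keys a. ?\<psi> (\<sigma> (var u)) ^ lookup a u))"
  proof (rule hom_as_substitution[of "range Inl" "\<lambda>g. ?\<psi> (\<sigma> g)", OF _ _ _ f])
    show "?\<psi> (\<sigma> 1) = 1"
      unfolding one_mpol const' by (simp add: const_mpol_def)
  qed (simp_all add: add mult embed_add embed_mult weight_exponent_add)
  also have "\<dots> = (\<Sum>a\<in>keys f. single 0 (lookup f a) * P a)"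
  proof (rule sum.cong[OF refl])
    fix a assume "a \<in> keys f"
    then have "keys a \<subseteq> range Inl" using f by (auto simp: polys_in_def)
    then have "(\<Prod>u\<in>keys a. ?\<psi> (\<sigma> (var u)) ^ lookup a u) =
        (\<Prod>u\<in>range Inl. ?\<psi> (\<sigma> (var u)) ^ lookup a u)"
      by (intro prod.mono_neutral_left) (auto simp: in_keys_iff)
    also have "\<dots> = P a"
      unfolding P_def p_def by (subst prod.reindex) simp_all
    finally show "?\<psi> (\<sigma> (const_mpol (lookup f a))) *
        (\<Prod>u\<in>keys a. ?\<psi> (\<sigma> (var u)) ^ lookup a u) = single 0 (lookup f a) * P a"
      by (simp add: const')
  qed
  finally have image: "relabel (\<lambda>a. ?E a 0) f = (\<Sum>a\<in>keys f. single 0 (lookup f a) * P a)"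
    unfolding fixed \<psi>_const .

  \<comment> \<open>Among the terms of \<open>\<sigma>(f)\<close>, only that of \<open>a0\<close> is heavy enough to contain the leading monomial of
    \<open>P a0\<close>, so nothing cancels it, although it is heavier than every monomial of \<open>f\<close>.\<close>
  let ?t = "lead (P a0)"
  have "lookup (relabel (\<lambda>a. ?E a 0) f) ?t =
      (\<Sum>a\<in>keys f. if a = a0 then lookup f a0 * lookup (P a0) ?t else 0)"
    unfolding image lookup_sum lookup_scale
  proof (rule sum.cong[OF refl])
    fix a assume a: "a \<in> keys f"
    show "lookup f a * lookup (P a) ?t =
        (if a = a0 then lookup f a0 * lookup (P a0) ?t else 0)"
    proof (cases "a = a0")
      case False
      then have "top_weight (P a) < top_weight (P a0)"
        using P_le[of a] gap[OF a] P_a0 by linarith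
      then have "?t \<notin> keys (P a)"
        using le_top_weight[of ?t "P a"] by (auto simp: top_weight_def[of "P a0"])
      with False show ?thesis by (simp add: in_keys_iff)
    qed simp
  qed
  also have "\<dots> = lookup f a0 * lookup (P a0) ?t"
    using a0(1) by simp
  also have "\<dots> \<noteq> 0"
    using a0(1) lead_in_keys[OF P_nz[of a0]] by (simp add: in_keys_iff)
  finally have "?t \<in> keys (relabel (\<lambda>a. ?E a 0) f)" by (simp add: in_keys_iff)
  then obtain b where b: "b \<in> keys f" "?t = ?E b 0"
    using keys_relabel[of "\<lambda>a. ?E a 0" f] by blast
  then have "top_weight (P a0) = w \<bullet> ?e b"
    unfolding top_weight_def b(2) lookup_weight_exponent_0 by simp
  also have "\<dots> \<le> w \<bullet> v"
    using w[OF b(1)] a0(2) by (cases "b = a0") auto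
  finally show False using P_a0 by simp
qed

theorem theorem1p1:
  fixes f :: "('n::finite + nat, 'k::idom) mpol"
  assumes "stable_Ga_invariant f"
  shows "\<not> (\<exists>v. is_intruder f v)"
proof
  assume "\<exists>v. is_intruder f v"
  then obtain v where v: "is_intruder f v" by blast
  let ?A = "poly_ring CARD('n) :: ('n + nat, 'k) mpol set"
  have A: "?A = polys_in (range Inl)"
    by (simp add: poly_ring_def first_vars_def)
  obtain m \<sigma> where f: "f \<in> ?A"
    and action: "is_Ga_action (poly_ring m) \<sigma>"
    and invariant: "f \<in> Ga_invariants (poly_ring m) \<sigma>"
    and nontrivial: "\<not> ?A \<subseteq> Ga_invariants (poly_ring m) \<sigma>"
    using assms unfolding stable_Ga_invariant_def by blast
  have sub: "g \<in> poly_ring m" if "g \<in> polys_in (range Inl)" for g :: "('n + nat, 'k) mpol"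
    using that by (auto simp: poly_ring_def first_vars_def polys_in_def)
  have at_0: "coeff (\<sigma> g) 0 = g" if "g \<in> poly_ring m" for g
    using action that by (simp add: is_Ga_action_def poly_0_coeff_0)
  have var_in: "var (Inl i) \<in> polys_in (range Inl)" for i :: 'n
    unfolding var_def by (rule single_in_polys_in) auto
  have add: "\<sigma> (g + h) = \<sigma> g + \<sigma> h" and mult: "\<sigma> (g * h) = \<sigma> g * \<sigma> h"
    if "g \<in> polys_in (range Inl)" "h \<in> polys_in (range Inl)" for g h
    using action that by (auto simp: is_Ga_action_def is_k_algebra_hom_def sub)
  have const: "\<sigma> (const_mpol c) = [:const_mpol c:]" for c
    using action by (simp add: is_Ga_action_def is_k_algebra_hom_def)
  have "\<sigma> f = [:f:]"
    using invariant at_0[OF sub[of f]] f A by (auto simp: Ga_invariants_def)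
  then have vars: "\<sigma> (var (Inl i)) = [:var (Inl i):]" for i
    using intruder_imp_variables_fixed[OF add mult const at_0[OF sub[OF var_in]] _ _ v] f A by auto
  have "\<sigma> g = [:g:]" if g: "g \<in> polys_in (range Inl)" for g
  proof -
    have "\<sigma> g = (\<Sum>a\<in>keys g. \<sigma> (const_mpol (lookup g a)) *
        (\<Prod>v\<in>keys a. \<sigma> (var v) ^ lookup a v))"
      by (rule hom_as_substitution[OF add mult _ g]) (simp_all add: one_mpol const one_pCons)
    also have "\<dots> = (\<Sum>a\<in>keys g. [:const_mpol (lookup g a):] *
        (\<Prod>v\<in>keys a. [:var v:] ^ lookup a v))"
    proof (intro sum.cong prod.cong arg_cong2[where f = "(*)"] arg_cong2[where f = "(^)"] refl const)
      fix a v assume "a \<in> keys g" "v \<in> keys a"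
      then have "v \<in> range Inl" using g by (auto simp: polys_in_def)
      then show "\<sigma> (var v) = [:var v:]" using vars by auto
    qed
    also have "\<dots> = [:g:]"
      by (rule hom_as_substitution[where h = "\<lambda>g. [:g:]", OF _ _ _ g, symmetric])
        (simp_all add: one_pCons)
    finally show ?thesis .
  qed
  then have "?A \<subseteq> Ga_invariants (poly_ring m) \<sigma>"
    using A sub by (auto simp: Ga_invariants_def)
  with nontrivial show False by blast
qed

end
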